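(* Let $(X,d)$ be an infinite metric space and let $\mathfrak{B}$ be a bornology on $X$ with closed base, $X\notin\mathfrak{B}$. If $X$ has the $\mathfrak{B}^s$-Hurewicz property, then every (countable) open $\mathfrak{B}^s$-cover of $X$ is $\mathfrak{B}^s$-groupable.
   Context: A bornology $\mathfrak{B}$ on $X$ is a family of subsets of $X$ that is closed under finite unions, hereditary (closed under taking subsets), and covers $X$. A base of $\mathfrak{B}$ is a subfamily of $\mathfrak{B}$ cofinal with respect to inclusion; it is closed if all its members are closed in $X$. For $B\in\mathfrak{B}$ and $\delta>0$, $B^\delta=\bigcup_{x\in B}\{y\in X: d(x,y)<\delta\}$. All open covers of $X$ are assumed to be countably infinite. An open $\mathfrak{B}^s$-cover of $X$ is an open cover $\mathcal{U}$ with $X\notin\mathcal{U}$ such that for each $B\in\mathfrak{B}$ there are $U\in\mathcal{U}$ and $\delta>0$ with $B^\delta\subseteq U$. $X$ has the $\mathfrak{B}^s$-Hurewicz property (strong $\mathfrak{B}$-Hurewicz property) if for each sequence $\{\mathcal{U}_n:n\in\mathbb{N}\}$ of open $\mathfrak{B}^s$-covers of $X$ there is a sequence $\{\mathcal{V}_n:n\in\mathbb{N}\}$, with $\mathcal{V}_n$ a finite subset of $\mathcal{U}_n$ for each $n$, such that for every $B\in\mathfrak{B}$ there exist $n_0\in\mathbb{N}$ and a sequence $\{\delta_n:n\ge n_0\}$ of positive reals such that for all $n\ge n_0$, $B^{\delta_n}\subseteq U$ for some $U\in\mathcal{V}_n$. An open cover $\mathcal{U}$ of $X$ is $\mathfrak{B}^s$-groupable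 if it can be expressed as a union of countably many finite pairwise disjoint sets $\mathcal{U}_n$ such that for each $B\in\mathfrak{B}$ there exist $n_0\in\mathbb{N}$ and a sequence $\{\delta_n:n\ge n_0\}$ of positive reals such that for all $n\ge n_0$, $B^{\delta_n}\subseteq U$ for some $U\in\mathcal{U}_n$. *)

theory Defs
  imports "HOL-Analysis.Analysis"
begin

text \<open>The metric space \<open>X\<close> is the whole type, so \<open>X\<close> itself is written \<open>UNIV\<close>.\<close>

definition bornology :: "'a set set \<Rightarrow> bool" where
  "bornology \<BB> \<longleftrightarrow>
     (\<forall>\<F>. finite \<F> \<and> \<F> \<subseteq> \<BB> \<longrightarrow> \<Union>\<F> \<in> \<BB>) \<and>
     (\<forall>B\<in>\<BB>. \<forall>A. A \<subseteq> B \<longrightarrow> A \<in> \<BB>) \<and>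
     \<Union>\<BB> = UNIV"

definition bornology_base :: "'a set set \<Rightarrow> 'a set set \<Rightarrow> bool" where
  "bornology_base \<BB> \<BB>\<^sub>0 \<longleftrightarrow> \<BB>\<^sub>0 \<subseteq> \<BB> \<and> (\<forall>B\<in>\<BB>. \<exists>B\<^sub>0\<in>\<BB>\<^sub>0. B \<subseteq> B\<^sub>0)"

definition has_closed_base :: "'a::topological_space set set \<Rightarrow> bool" where
  "has_closed_base \<BB> \<longleftrightarrow> (\<exists>\<BB>\<^sub>0. bornology_base \<BB> \<BB>\<^sub>0 \<and> (\<forall>B\<in>\<BB>\<^sub>0. closed B))"

definition enlargement :: "'a::metric_space set \<Rightarrow> real \<Rightarrow> 'a set" where
  "enlargement B \<delta> = (\<Union>x\<in>B. ball x \<delta>)"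

text \<open>Standing convention: open covers are countably infinite.\<close>

definition open_cover :: "'a::topological_space set set \<Rightarrow> bool" where
  "open_cover \<U> \<longleftrightarrow> countable \<U> \<and> infinite \<U> \<and> (\<forall>U\<in>\<U>. open U) \<and> \<Union>\<U> = UNIV"

definition open_Bs_cover :: "'a::metric_space set set \<Rightarrow> 'a set set \<Rightarrow> bool" where
  "open_Bs_cover \<BB> \<U> \<longleftrightarrow>
     open_cover \<U> \<and> UNIV \<notin> \<U> \<and>
     (\<forall>B\<in>\<BB>. \<exists>U\<in>\<U>. \<exists>\<delta>>0. enlargement B \<delta> \<subseteq> U)"

definition Bs_Hurewicz :: "'a::metric_space set set \<Rightarrow> bool" where
  "Bs_Hurewicz \<BB> \<longleftrightarrow>
     (\<forall>\<U> :: nat \<Rightarrow> 'a set set. (\<forall>n. open_Bs_cover \<BB> (\<U> n)) \<longrightarrow>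
        (\<exists>\<V> :: nat \<Rightarrow> 'a set set. (\<forall>n. finite (\<V> n) \<and> \<V> n \<subseteq> \<U> n) \<and>
           (\<forall>B\<in>\<BB>. \<exists>n\<^sub>0. \<exists>\<delta> :: nat \<Rightarrow> real.
              \<forall>n\<ge>n\<^sub>0. \<delta> n > 0 \<and> (\<exists>U\<in>\<V> n. enlargement B (\<delta> n) \<subseteq> U))))"

definition Bs_groupable :: "'a::metric_space set set \<Rightarrow> 'a set set \<Rightarrow> bool" where
  "Bs_groupable \<BB> \<U> \<longleftrightarrow>
     open_cover \<U> \<and>
     (\<exists>\<G> :: nat \<Rightarrow> 'a set set.
        \<U> = (\<Union>n. \<G> n) \<and> (\<forall>n. finite (\<G> n)) \<and> disjoint_family \<G> \<and>
        (\<forall>B\<in>\<BB>. \<exists>n\<^sub>0. \<exists>\<delta> :: nat \<Rightarrow> real.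
           \<forall>n\<ge>n\<^sub>0. \<delta> n > 0 \<and> (\<exists>U\<in>\<G> n. enlargement B (\<delta> n) \<subseteq> U)))"

end

theory Submission
  imports Defs
begin

text \<open>Removing finitely many sets from an open \<open>\<BB>\<^sup>s\<close>-cover leaves an open \<open>\<BB>\<^sup>s\<close>-cover
  (\<open>open_Bs_cover_Diff_finite\<close>).  So, for an enumeration \<open>e\<close> of \<open>\<U>\<close>, the Hurewicz property can be
  applied to the tails \<open>\<U> - e ` {..<n}\<close>.  It yields finite selections \<open>\<V> n\<close> that use only indices
  \<open>\<ge> n\<close>, and all indices occurring in \<open>\<V> n\<close> lie below some bound \<open>N n > n\<close>.  Iterating \<open>N\<close> from \<open>0\<close>
  gives cut points \<open>m k\<close> such that the block \<open>e ` {m k..<m (Suc k)}\<close> contains \<open>\<V> (m k)\<close>.  The blocks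
  are finite, disjoint and exhaust \<open>\<U>\<close>, and each of them inherits from \<open>\<V> (m k)\<close> the members needed
  to swallow the enlargements of sets in \<open>\<BB>\<close>.\<close>

lemma subset_enlargement: "\<delta> > 0 \<Longrightarrow> B \<subseteq> enlargement B \<delta>"
  unfolding enlargement_def by (auto intro: centre_in_ball[THEN iffD2])

lemma enlargement_mono: "A \<subseteq> B \<Longrightarrow> enlargement A \<delta> \<subseteq> enlargement B \<delta>"
  unfolding enlargement_def by (rule UN_mono) auto

text \<open>Adjoin to \<open>B\<close> one point outside each removed set, which exists because the whole space is
  not a member of the cover.  The result still belongs to \<open>\<BB>\<close>, and a cover member that contains it cannot
  be one of the removed sets.\<close>

lemma open_Bs_cover_Diff_finite:
  fixes \<BB> :: "'a::metric_space set set"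
  assumes born: "bornology \<BB>" and cov: "open_Bs_cover \<BB> \<U>" and fin: "finite \<F>"
  shows "open_Bs_cover \<BB> (\<U> - \<F>)"
proof -
  have singletons: "{x} \<in> \<BB>" for x
    using born unfolding bornology_def by (metis UNIV_I UnionE empty_subsetI insert_subset)
  have swallow: "\<exists>U\<in>\<U> - \<F>. \<exists>\<delta>>0. enlargement B \<delta> \<subseteq> U" if "B \<in> \<BB>" for B
  proof -
    have "\<forall>F\<in>\<U> \<inter> \<F>. \<exists>x. x \<notin> F"
      using cov unfolding open_Bs_cover_def by (metis IntD1 UNIV_eq_I)
    then obtain p where p: "\<And>F. F \<in> \<U> \<inter> \<F> \<Longrightarrow> p F \<notin> F"
      by metis
    define C where "C = B \<union> p ` (\<U> \<inter> \<F>)"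
    have "finite (insert B ((\<lambda>F. {p F}) ` (\<U> \<inter> \<F>)))"
      "insert B ((\<lambda>F. {p F}) ` (\<U> \<inter> \<F>)) \<subseteq> \<BB>"
      using fin that singletons by auto
    then have "\<Union>(insert B ((\<lambda>F. {p F}) ` (\<U> \<inter> \<F>))) \<in> \<BB>"
      using born unfolding bornology_def by blast
    moreover have "\<Union>(insert B ((\<lambda>F. {p F}) ` (\<U> \<inter> \<F>))) = C"
      unfolding C_def by auto
    ultimately obtain U \<delta> where U: "U \<in> \<U>" "\<delta> > 0" "enlargement C \<delta> \<subseteq> U"
      using cov unfolding open_Bs_cover_def by metis
    have "C \<subseteq> U"
      using subset_enlargement[OF U(2)] U(3) by (rule subset_trans)
    have "enlargement B \<delta> \<subseteq> U"
      using enlargement_mono U(3) by (rule subset_trans) (simp add: C_def)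
    have "U \<notin> \<F>"
      using p[of U] U(1) \<open>C \<subseteq> U\<close> unfolding C_def by blast
    with U \<open>enlargement B \<delta> \<subseteq> U\<close> show ?thesis by blast
  qed
  have "\<Union>(\<U> - \<F>) = UNIV"
  proof -
    have "x \<in> \<Union>(\<U> - \<F>)" for x
    proof -
      obtain U \<delta> where U: "U \<in> \<U> - \<F>" "\<delta> > 0" "enlargement {x} \<delta> \<subseteq> U"
        using swallow[OF singletons[of x]] by (elim bexE exE conjE)
      have "x \<in> U"
        using subset_enlargement[OF U(2), of "{x}"] U(3) by (simp add: subset_iff)
      with U(1) show ?thesis by (rule UnionI)
    qed
    then show ?thesis by blast
  qed
  moreover have "countable (\<U> - \<F>)" "infinite (\<U> - \<F>)" "\<forall>U\<in>\<U> - \<F>. open U" "UNIV \<notin> \<U> - \<F>"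
    using cov fin unfolding open_Bs_cover_def open_cover_def by auto
  ultimately show ?thesis
    using swallow unfolding open_Bs_cover_def open_cover_def by simp
qed

lemma UN_atLeastLessThan_strict_mono:
  fixes m :: "nat \<Rightarrow> nat"
  assumes "strict_mono m" "m 0 = 0"
  shows "(\<Union>k. {m k..<m (Suc k)}) = UNIV"
proof -
  have "{..<m k} \<subseteq> (\<Union>k. {m k..<m (Suc k)})" for k
  proof (induction k)
    case (Suc k)
    have "{..<m (Suc k)} \<subseteq> {..<m k} \<union> {m k..<m (Suc k)}" by auto
    with Suc show ?case by blast
  qed (simp add: assms)
  moreover have "j \<in> {..<m (Suc j)}" for j
    using strict_mono_imp_increasing[OF assms(1), of "Suc j"] by simp
  ultimately show ?thesis by blast
qed

lemma disjoint_family_atLeastLessThan_mono: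
  fixes m :: "nat \<Rightarrow> nat"
  assumes "mono m"
  shows "disjoint_family (\<lambda>k. {m k..<m (Suc k)})"
proof -
  have "{m i..<m (Suc i)} \<inter> {m j..<m (Suc j)} = {}" if "i < j" for i j
    using monoD[OF assms, of "Suc i" j] that by auto
  then show ?thesis
    unfolding disjoint_family_on_def by (metis Int_commute linorder_neqE_nat)
qed

theorem lemma4p2:
  fixes \<BB> :: "'a::metric_space set set"
  assumes "infinite (UNIV :: 'a set)"
    and "bornology \<BB>"
    and "has_closed_base \<BB>"
    and "UNIV \<notin> \<BB>"
    and "Bs_Hurewicz \<BB>"
  shows "\<forall>\<U>. open_Bs_cover \<BB> \<U> \<longrightarrow> Bs_groupable \<BB> \<U>"
proof (intro allI impI)
  fix \<U> assume cov: "open_Bs_cover \<BB> \<U>"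
  then have oc: "open_cover \<U>"
    unfolding open_Bs_cover_def by blast
  define e where "e = from_nat_into \<U>"
  have e: "inj e" "range e = \<U>"
    using oc bij_betw_from_nat_into[of \<U>]
    unfolding open_cover_def e_def bij_betw_def by auto
  have tails: "\<forall>n. open_Bs_cover \<BB> (\<U> - e ` {..<n})"
    using open_Bs_cover_Diff_finite[OF assms(2) cov] by simp
  obtain \<V> where "\<forall>n. finite (\<V> n) \<and> \<V> n \<subseteq> \<U> - e ` {..<n}"
    and sel: "\<forall>B\<in>\<BB>. \<exists>n\<^sub>0. \<exists>\<delta> :: nat \<Rightarrow> real.
                \<forall>n\<ge>n\<^sub>0. \<delta> n > 0 \<and> (\<exists>U\<in>\<V> n. enlargement B (\<delta> n) \<subseteq> U)"
    using assms(5)[unfolded Bs_Hurewicz_def, THEN spec, THEN mp, OF tails] by (elim exE conjE)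
  then have \<V>: "\<And>n. finite (\<V> n)" "\<And>n. \<V> n \<subseteq> \<U> - e ` {..<n}"
    by simp_all
  have "\<exists>N>n. \<V> n \<subseteq> e ` {n..<N}" for n
  proof -
    define I where "I = e -` \<V> n"
    have I: "finite I" "\<V> n = e ` I"
      using finite_vimageI[OF \<V>(1) e(1)] \<V>(2)[of n] e(2) by (auto simp: I_def)
    have "I \<subseteq> {n..}"
      using \<V>(2)[of n] unfolding I_def by fastforce
    moreover obtain M where "I \<subseteq> {..<M}"
      using I(1) unfolding finite_nat_iff_bounded by (elim exE)
    ultimately have "I \<subseteq> {n..<max (Suc n) M}" by (auto simp: less_max_iff_disj)
    with I(2) show ?thesis
      by (intro exI[of _ "max (Suc n) M"]) auto
  qed
  then obtain N where N: "\<And>n. n < N n" "\<And>n. \<V> n \<subseteq> e ` {n..<N n}"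
    by metis
  define m where "m k = (N ^^ k) 0" for k
  have m: "strict_mono m" "m 0 = 0" "\<And>k. \<V> (m k) \<subseteq> e ` {m k..<m (Suc k)}"
    using N by (auto simp: m_def strict_mono_Suc_iff)
  define \<G> where "\<G> k = e ` {m k..<m (Suc k)}" for k
  have "\<U> = (\<Union>k. \<G> k)"
    unfolding \<G>_def image_UN[symmetric] UN_atLeastLessThan_strict_mono[OF m(1,2)] e(2) ..
  moreover have "disjoint_family \<G>"
    using disjoint_family_atLeastLessThan_mono[OF strict_mono_mono[OF m(1)]] e(1)
    unfolding disjoint_family_on_def \<G>_def by (simp flip: image_Int)
  moreover have "\<forall>n. finite (\<G> n)"
    unfolding \<G>_def by simp
  moreover have "\<forall>B\<in>\<BB>. \<exists>n\<^sub>0. \<exists>\<delta> :: nat \<Rightarrow> real.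
      \<forall>n\<ge>n\<^sub>0. \<delta> n > 0 \<and> (\<exists>U\<in>\<G> n. enlargement B (\<delta> n) \<subseteq> U)"
  proof
    fix B assume "B \<in> \<BB>"
    obtain n\<^sub>0 \<delta> where *: "\<forall>n\<ge>n\<^sub>0. \<delta> n > (0::real) \<and> (\<exists>U\<in>\<V> n. enlargement B (\<delta> n) \<subseteq> U)"
      using bspec[OF sel \<open>B \<in> \<BB>\<close>] by (elim exE)
    have "\<delta> (m k) > 0 \<and> (\<exists>U\<in>\<G> k. enlargement B (\<delta> (m k)) \<subseteq> U)" if "k \<ge> n\<^sub>0" for k
    proof -
      have "m k \<ge> n\<^sub>0"
        using strict_mono_imp_increasing[OF m(1), of k] that by linarith
      with * have "\<delta> (m k) > 0 \<and> (\<exists>U\<in>\<V> (m k). enlargement B (\<delta> (m k)) \<subseteq> U)"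
        by simp
      with m(3)[of k] show ?thesis
        unfolding \<G>_def by (meson subsetD)
    qed
    then show "\<exists>n\<^sub>0. \<exists>\<delta> :: nat \<Rightarrow> real.
        \<forall>n\<ge>n\<^sub>0. \<delta> n > 0 \<and> (\<exists>U\<in>\<G> n. enlargement B (\<delta> n) \<subseteq> U)"
      by (intro exI[of _ n\<^sub>0] exI[of _ "\<lambda>k. \<delta> (m k)"] allI impI)
  qed
  ultimately show "Bs_groupable \<BB> \<U>"
    using oc unfolding Bs_groupable_def by (intro conjI exI[of _ \<G>])
qed

end
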